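(* Let $G=(G,* )$ be a left quasigroup satisfying $$(a*c)\backslash_G((a*b)*c)=(a'*c)\backslash_G((a'*b)*c)\quad(\forall a,a',b,c\in G).$$ Let $M$ be the ternary system $(G,\mu^G_1)$ or the ternary system $(G,\mu^G_2)$, where $$\mu^G_1(a,b,c)=a*(b\backslash_G c),\qquad \mu^G_2(a,b,c)=c*(b\backslash_G a)\qquad(a,b,c\in G).$$ Let $L$ be a left quasigroup and $\pi:L\to G$ a bijection. Then the dynamical Yang-Baxter map $R^{(L,M,\pi)}(\lambda)$ satisfies the unitary condition if and only if $$(a*b)*c=(a*c)*b\quad(\forall a,b,c\in G).$$
   Context: A left quasigroup $(L,\cdot)$ is a nonempty set $L$ with a binary operation such that for all $u,w\in L$ there is a unique $v\in L$ with $u\cdot v=w$; this $v$ is denoted $u\backslash_L w$ (similarly $\backslash_G$ for $(G,* )$), and $uv$ means $u\cdot v$. A ternary system $(M,\mu)$ is a nonempty set $M$ with a map $\mu:M^3\to M$. Given a left quasigroup $L$, a ternary system $M=(M,\mu)$ and a bijection $\pi:L\to M$, for $\lambda,u,v\in L$: $$\xi^{(L,M,\pi)}_\lambda(u)(v)=\lambda\backslash_L\pi^{-1}\bigl(\mu(\pi(\lambda),\pi(\lambda u),\pi((\lambda u)v))\bigr),$$ $$\eta^{(L,M,\pi)}_\lambda(u)(v)=\bigl(\lambda\,\xi^{(L,M,\pi)}_\lambda(v)(u)\bigr)\backslash_L\bigl((\lambda v)u\bigr),$$ $$R^{(L,M,\pi)}(\lambda)(u,v)=\bigl(\eta^{(L,M,\pi)}_\lambda(v)(u),\xi^{(L,M,\pi)}_\lambda(u)(v)\bigr).$$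 A family $R(\lambda):L\times L\to L\times L$ ($\lambda\in L$) satisfies the unitary condition iff $R(\lambda)P_LR(\lambda)=P_L$ for all $\lambda\in L$, where $P_L(u,v)=(v,u)$. *)

theory Defs
  imports "HOL-Algebra.Congruence"
begin

record 'a binary_system = "'a partial_object" +
  bop :: "'a \<Rightarrow> 'a \<Rightarrow> 'a" (infixl "\<cdot>\<index>" 70)

record 'a ternary_system = "'a partial_object" +
  top3 :: "'a \<Rightarrow> 'a \<Rightarrow> 'a \<Rightarrow> 'a"

definition left_quasigroup :: "('a, 'm) binary_system_scheme \<Rightarrow> bool" where
  "left_quasigroup Q \<longleftrightarrow>
     carrier Q \<noteq> {} \<and>
     (\<forall>u\<in>carrier Q. \<forall>v\<in>carrier Q. u \<cdot>\<^bsub>Q\<^esub> v \<in> carrier Q) \<and>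
     (\<forall>u\<in>carrier Q. \<forall>w\<in>carrier Q. \<exists>!v. v \<in> carrier Q \<and> u \<cdot>\<^bsub>Q\<^esub> v = w)"

text \<open>\<open>ldiv Q u w\<close> is the left quotient usually written with a backslash; it is meaningful only
  for \<open>u\<close>, \<open>w\<close> in the carrier of a left quasigroup.\<close>

definition ldiv :: "('a, 'm) binary_system_scheme \<Rightarrow> 'a \<Rightarrow> 'a \<Rightarrow> 'a" where
  "ldiv Q u w = (THE v. v \<in> carrier Q \<and> u \<cdot>\<^bsub>Q\<^esub> v = w)"

definition is_ternary_system :: "('a, 'm) ternary_system_scheme \<Rightarrow> bool" where
  "is_ternary_system M \<longleftrightarrow>
     carrier M \<noteq> {} \<and>
     (\<forall>a\<in>carrier M. \<forall>b\<in>carrier M. \<forall>c\<in>carrier M. top3 M a b c \<in> carrier M)"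

definition mu1 :: "('a, 'm) binary_system_scheme \<Rightarrow> 'a \<Rightarrow> 'a \<Rightarrow> 'a \<Rightarrow> 'a" where
  "mu1 G a b c = a \<cdot>\<^bsub>G\<^esub> ldiv G b c"

definition mu2 :: "('a, 'm) binary_system_scheme \<Rightarrow> 'a \<Rightarrow> 'a \<Rightarrow> 'a \<Rightarrow> 'a" where
  "mu2 G a b c = c \<cdot>\<^bsub>G\<^esub> ldiv G b a"

definition xi ::
  "('l, 'm) binary_system_scheme \<Rightarrow> ('g, 'n) ternary_system_scheme \<Rightarrow> ('l \<Rightarrow> 'g)
     \<Rightarrow> 'l \<Rightarrow> 'l \<Rightarrow> 'l \<Rightarrow> 'l" where
  "xi L M \<pi> l u v =
     ldiv L l (inv_into (carrier L) \<pi>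
       (top3 M (\<pi> l) (\<pi> (l \<cdot>\<^bsub>L\<^esub> u)) (\<pi> ((l \<cdot>\<^bsub>L\<^esub> u) \<cdot>\<^bsub>L\<^esub> v))))"

definition eta ::
  "('l, 'm) binary_system_scheme \<Rightarrow> ('g, 'n) ternary_system_scheme \<Rightarrow> ('l \<Rightarrow> 'g)
     \<Rightarrow> 'l \<Rightarrow> 'l \<Rightarrow> 'l \<Rightarrow> 'l" where
  "eta L M \<pi> l u v =
     ldiv L (l \<cdot>\<^bsub>L\<^esub> xi L M \<pi> l v u) ((l \<cdot>\<^bsub>L\<^esub> v) \<cdot>\<^bsub>L\<^esub> u)"

definition R_map ::
  "('l, 'm) binary_system_scheme \<Rightarrow> ('g, 'n) ternary_system_scheme \<Rightarrow> ('l \<Rightarrow> 'g)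
     \<Rightarrow> 'l \<Rightarrow> 'l \<times> 'l \<Rightarrow> 'l \<times> 'l" where
  "R_map L M \<pi> l = (\<lambda>(u, v). (eta L M \<pi> l v u, xi L M \<pi> l u v))"

definition unitary_condition ::
  "('l, 'm) binary_system_scheme \<Rightarrow> ('l \<Rightarrow> 'l \<times> 'l \<Rightarrow> 'l \<times> 'l) \<Rightarrow> bool" where
  "unitary_condition L R \<longleftrightarrow>
     (\<forall>l\<in>carrier L. \<forall>p\<in>carrier L \<times> carrier L.
        (R l \<circ> prod.swap \<circ> R l) p = prod.swap p)"

lemma ldiv_closed:
  assumes "left_quasigroup Q" "u \<in> carrier Q" "w \<in> carrier Q"
  shows "ldiv Q u w \<in> carrier Q" and "u \<cdot>\<^bsub>Q\<^esub> ldiv Q u w = w"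
proof -
  have "\<exists>!v. v \<in> carrier Q \<and> u \<cdot>\<^bsub>Q\<^esub> v = w"
    using assms unfolding left_quasigroup_def by blast
  from theI'[OF this] show "ldiv Q u w \<in> carrier Q" and "u \<cdot>\<^bsub>Q\<^esub> ldiv Q u w = w"
    unfolding ldiv_def by auto
qed

lemma bop_closed:
  "\<lbrakk>left_quasigroup Q; u \<in> carrier Q; v \<in> carrier Q\<rbrakk> \<Longrightarrow> u \<cdot>\<^bsub>Q\<^esub> v \<in> carrier Q"
  by (simp add: left_quasigroup_def)

lemma is_ternary_system_mu1:
  "left_quasigroup G \<Longrightarrow> is_ternary_system \<lparr>carrier = carrier G, top3 = mu1 G\<rparr>"
  by (auto simp: is_ternary_system_def mu1_def bop_closed ldiv_closed)
    (simp add: left_quasigroup_def)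

lemma is_ternary_system_mu2:
  "left_quasigroup G \<Longrightarrow> is_ternary_system \<lparr>carrier = carrier G, top3 = mu2 G\<rparr>"
  by (auto simp: is_ternary_system_def mu2_def bop_closed ldiv_closed)
    (simp add: left_quasigroup_def)

lemma R_map_closed:
  assumes L: "left_quasigroup L" and M: "is_ternary_system M"
    and \<pi>: "bij_betw \<pi> (carrier L) (carrier M)"
    and l: "l \<in> carrier L" and p: "p \<in> carrier L \<times> carrier L"
  shows "R_map L M \<pi> l p \<in> carrier L \<times> carrier L"
proof -
  obtain u v where uv: "p = (u, v)" "u \<in> carrier L" "v \<in> carrier L"
    using p by blast
  have \<pi>_in: "\<pi> x \<in> carrier M" if "x \<in> carrier L" for x
    using \<pi> that by (rule bij_betwE[THEN bspec])
  have inv_in: "inv_into (carrier L) \<pi> y \<in> carrier L" if "y \<in> carrier M" for y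
    using \<pi> that by (metis bij_betw_imp_surj_on inv_into_into)
  have top3_in: "top3 M a b c \<in> carrier M"
    if "a \<in> carrier M" "b \<in> carrier M" "c \<in> carrier M" for a b c
    using M that by (simp add: is_ternary_system_def)
  have x: "xi L M \<pi> l u v \<in> carrier L"
    unfolding xi_def by (intro ldiv_closed L l inv_in top3_in \<pi>_in bop_closed uv)
  have "eta L M \<pi> l v u \<in> carrier L"
    unfolding eta_def by (intro ldiv_closed L l x bop_closed uv)
  with x show ?thesis by (simp add: R_map_def uv)
qed

end

theory Submission
  imports Defs
begin

text \<open>
  Replace a pair \<open>(u, v)\<close> by the three vertices \<open>l\<close>, \<open>l u\<close>, \<open>(l u) v\<close> that it
  traverses from \<open>l\<close>.  In a left quasigroup the last two vertices determine the pair, and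
  \<open>R(l)\<close> followed by the flip fixes the outer vertices while replacing the middle one,
  transported along \<open>\<pi>\<close>, by \<open>\<mu>\<close> of the three.  The unitary condition says that this
  operation on paths is an involution, that is, \<open>\<mu>(a, \<mu>(a, b, c), c) = b\<close> throughout
  (lemma \<open>unitary_iff_involution\<close>).

  For both operations attached to \<open>G\<close>, one of the outer vertices can be written as \<open>b * e\<close>.
  The identity then becomes \<open>a * ((a * e) \ (b * e)) = b\<close>: simultaneous right
  multiplication by \<open>e\<close> preserves left quotients.  Writing \<open>b = a * f\<close> turns this into
  \<open>(a * f) * e = (a * e) * f\<close> (lemma \<open>right_translation_preserves_ldiv_iff\<close>).
\<close>

lemma ldiv_bop:
  assumes "left_quasigroup Q" "u \<in> carrier Q" "v \<in> carrier Q"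
  shows "ldiv Q u (u \<cdot>\<^bsub>Q\<^esub> v) = v"
proof -
  have "\<exists>!x. x \<in> carrier Q \<and> u \<cdot>\<^bsub>Q\<^esub> x = u \<cdot>\<^bsub>Q\<^esub> v"
    using assms by (simp add: left_quasigroup_def)
  then show ?thesis
    unfolding ldiv_def using assms by (intro the1_equality) auto
qed

lemma bop_left_cancel:
  assumes "left_quasigroup Q" "u \<in> carrier Q" "v \<in> carrier Q" "w \<in> carrier Q"
  shows "u \<cdot>\<^bsub>Q\<^esub> v = u \<cdot>\<^bsub>Q\<^esub> w \<longleftrightarrow> v = w"
  using assms ldiv_bop by metis

text \<open>The defining formulas of \<open>\<xi>\<close> and \<open>\<eta>\<close> are left quotients; clearing them shows the
  effect of \<open>R(l)\<close> on vertices: the flipped output \<open>(x, e)\<close> ends where \<open>(u, v)\<close> ends, and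
  only its middle vertex is new.\<close>

lemma R_map_path:
  assumes L: "left_quasigroup L" and M: "is_ternary_system M"
    and \<pi>: "bij_betw \<pi> (carrier L) (carrier M)"
    and l: "l \<in> carrier L" and u: "u \<in> carrier L" and v: "v \<in> carrier L"
    and R: "R_map L M \<pi> l (u, v) = (e, x)"
  shows "e \<in> carrier L" and "x \<in> carrier L"
    and "\<pi> (l \<cdot>\<^bsub>L\<^esub> x) = top3 M (\<pi> l) (\<pi> (l \<cdot>\<^bsub>L\<^esub> u)) (\<pi> ((l \<cdot>\<^bsub>L\<^esub> u) \<cdot>\<^bsub>L\<^esub> v))"
    and "(l \<cdot>\<^bsub>L\<^esub> x) \<cdot>\<^bsub>L\<^esub> e = (l \<cdot>\<^bsub>L\<^esub> u) \<cdot>\<^bsub>L\<^esub> v"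
proof -
  show e: "e \<in> carrier L" and x: "x \<in> carrier L"
    using R_map_closed[OF L M \<pi> l, of "(u, v)"] u v R by auto
  have lu: "l \<cdot>\<^bsub>L\<^esub> u \<in> carrier L" and luv: "(l \<cdot>\<^bsub>L\<^esub> u) \<cdot>\<^bsub>L\<^esub> v \<in> carrier L"
    using L l u v by (simp_all add: bop_closed)
  let ?m = "top3 M (\<pi> l) (\<pi> (l \<cdot>\<^bsub>L\<^esub> u)) (\<pi> ((l \<cdot>\<^bsub>L\<^esub> u) \<cdot>\<^bsub>L\<^esub> v))"
  have m: "?m \<in> carrier M"
    using M \<pi> l lu luv by (simp add: is_ternary_system_def bij_betw_apply)
  have "l \<cdot>\<^bsub>L\<^esub> x = inv_into (carrier L) \<pi> ?m"
    using R ldiv_closed(2)[OF L l, of "inv_into (carrier L) \<pi> ?m"] m \<pi>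
    by (auto simp: R_map_def xi_def bij_betw_def inv_into_into)
  then show "\<pi> (l \<cdot>\<^bsub>L\<^esub> x) = ?m"
    using \<pi> m by (simp add: bij_betw_inv_into_right)
  show "(l \<cdot>\<^bsub>L\<^esub> x) \<cdot>\<^bsub>L\<^esub> e = (l \<cdot>\<^bsub>L\<^esub> u) \<cdot>\<^bsub>L\<^esub> v"
    using R ldiv_closed(2)[OF L bop_closed[OF L l x] luv]
    by (auto simp: R_map_def eta_def)
qed

text \<open>Since \<open>R(l) P R(l) = P\<close> amounts to \<open>(P R(l))\<^sup>2 = id\<close>, applying the description
  on vertices twice leaves only the middle vertex to compare.  Every triple of elements of \<open>M\<close>
  arises from a path because \<open>\<pi>\<close> is onto and left division solves for \<open>u\<close> and
  \<open>v\<close>.\<close>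

lemma unitary_iff_involution:
  assumes L: "left_quasigroup L" and M: "is_ternary_system M"
    and \<pi>: "bij_betw \<pi> (carrier L) (carrier M)"
  shows "unitary_condition L (R_map L M \<pi>) \<longleftrightarrow>
    (\<forall>a\<in>carrier M. \<forall>b\<in>carrier M. \<forall>c\<in>carrier M. top3 M a (top3 M a b c) c = b)"
proof -
  have pointwise:
    "(R_map L M \<pi> l \<circ> prod.swap \<circ> R_map L M \<pi> l) (u, v) = (v, u) \<longleftrightarrow>
     top3 M (\<pi> l)
       (top3 M (\<pi> l) (\<pi> (l \<cdot>\<^bsub>L\<^esub> u)) (\<pi> ((l \<cdot>\<^bsub>L\<^esub> u) \<cdot>\<^bsub>L\<^esub> v)))
       (\<pi> ((l \<cdot>\<^bsub>L\<^esub> u) \<cdot>\<^bsub>L\<^esub> v)) = \<pi> (l \<cdot>\<^bsub>L\<^esub> u)"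
    if l: "l \<in> carrier L" and u: "u \<in> carrier L" and v: "v \<in> carrier L" for l u v
  proof -
    obtain e x where R1: "R_map L M \<pi> l (u, v) = (e, x)" by force
    note path1 = R_map_path[OF L M \<pi> l u v R1]
    obtain e' x' where R2: "R_map L M \<pi> l (x, e) = (e', x')" by force
    note path2 = R_map_path[OF L M \<pi> l path1(2,1) R2]
    have lu: "l \<cdot>\<^bsub>L\<^esub> u \<in> carrier L" and lx': "l \<cdot>\<^bsub>L\<^esub> x' \<in> carrier L"
      using L l u path2(2) by (simp_all add: bop_closed)
    have "x' = u \<Longrightarrow> e' = v"
      using path2(4) path1(4) bop_left_cancel[OF L lu path2(1) v] by simp
    then have "(e', x') = (v, u) \<longleftrightarrow> x' = u" by auto
    also have "\<dots> \<longleftrightarrow> \<pi> (l \<cdot>\<^bsub>L\<^esub> x') = \<pi> (l \<cdot>\<^bsub>L\<^esub> u)"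
      using bop_left_cancel[OF L l path2(2) u] lu lx' \<pi>
      by (auto simp: bij_betw_def inj_on_eq_iff)
    finally show ?thesis
      using path2(3) by (simp add: R1 R2 path1(3,4))
  qed
  show ?thesis
  proof (intro iffI ballI)
    fix a b c assume unitary: "unitary_condition L (R_map L M \<pi>)"
      and abc: "a \<in> carrier M" "b \<in> carrier M" "c \<in> carrier M"
    have "\<exists>x\<in>carrier L. y = \<pi> x" if "y \<in> carrier M" for y
      using \<pi> that by (auto simp: bij_betw_def)
    then obtain l y z where lyz: "l \<in> carrier L" "y \<in> carrier L" "z \<in> carrier L"
      and eq: "a = \<pi> l" "b = \<pi> y" "c = \<pi> z"
      using abc by meson
    let ?u = "ldiv L l y" and ?v = "ldiv L y z"
    have uv: "?u \<in> carrier L" "?v \<in> carrier L" "l \<cdot>\<^bsub>L\<^esub> ?u = y" "y \<cdot>\<^bsub>L\<^esub> ?v = z"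
      using L lyz by (simp_all add: ldiv_closed)
    have "(R_map L M \<pi> l \<circ> prod.swap \<circ> R_map L M \<pi> l) (?u, ?v) = (?v, ?u)"
      using unitary lyz(1) uv(1,2) unfolding unitary_condition_def by force
    with pointwise[OF lyz(1) uv(1,2)] show "top3 M a (top3 M a b c) c = b"
      by (simp only: uv(3,4) eq simp_thms)
  next
    assume inv: "\<forall>a\<in>carrier M. \<forall>b\<in>carrier M. \<forall>c\<in>carrier M.
      top3 M a (top3 M a b c) c = b"
    have "\<pi> x \<in> carrier M" if "x \<in> carrier L" for x
      using \<pi> that by (rule bij_betw_apply)
    then show "unitary_condition L (R_map L M \<pi>)"
      unfolding unitary_condition_def using L inv pointwise
      by (clarsimp simp: bop_closed simp del: comp_apply)
  qed
qed

lemma right_translation_preserves_ldiv_iff: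
  assumes G: "left_quasigroup G"
  shows "(\<forall>a\<in>carrier G. \<forall>b\<in>carrier G. \<forall>c\<in>carrier G.
      a \<cdot>\<^bsub>G\<^esub> ldiv G (a \<cdot>\<^bsub>G\<^esub> c) (b \<cdot>\<^bsub>G\<^esub> c) = b) \<longleftrightarrow>
    (\<forall>a\<in>carrier G. \<forall>b\<in>carrier G. \<forall>c\<in>carrier G.
      (a \<cdot>\<^bsub>G\<^esub> b) \<cdot>\<^bsub>G\<^esub> c = (a \<cdot>\<^bsub>G\<^esub> c) \<cdot>\<^bsub>G\<^esub> b)"
proof (intro iffI ballI)
  fix a b c assume in_G: "a \<in> carrier G" "b \<in> carrier G" "c \<in> carrier G"
    and eq: "\<forall>a\<in>carrier G. \<forall>b\<in>carrier G. \<forall>c\<in>carrier G.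
      a \<cdot>\<^bsub>G\<^esub> ldiv G (a \<cdot>\<^bsub>G\<^esub> c) (b \<cdot>\<^bsub>G\<^esub> c) = b"
  let ?ab = "a \<cdot>\<^bsub>G\<^esub> b" and ?ac = "a \<cdot>\<^bsub>G\<^esub> c"
  let ?q = "ldiv G ?ac (?ab \<cdot>\<^bsub>G\<^esub> c)"
  have q: "?q \<in> carrier G" "?ac \<cdot>\<^bsub>G\<^esub> ?q = ?ab \<cdot>\<^bsub>G\<^esub> c"
    using G in_G by (simp_all add: bop_closed ldiv_closed)
  have "a \<cdot>\<^bsub>G\<^esub> ?q = ?ab"
    using eq G in_G by (simp add: bop_closed)
  then have "?q = b"
    using bop_left_cancel[OF G in_G(1) q(1) in_G(2)] by simp
  with q(2) show "?ab \<cdot>\<^bsub>G\<^esub> c = ?ac \<cdot>\<^bsub>G\<^esub> b" by simp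
next
  fix a b c assume in_G: "a \<in> carrier G" "b \<in> carrier G" "c \<in> carrier G"
    and eq: "\<forall>a\<in>carrier G. \<forall>b\<in>carrier G. \<forall>c\<in>carrier G.
      (a \<cdot>\<^bsub>G\<^esub> b) \<cdot>\<^bsub>G\<^esub> c = (a \<cdot>\<^bsub>G\<^esub> c) \<cdot>\<^bsub>G\<^esub> b"
  let ?d = "ldiv G a b"
  have d: "?d \<in> carrier G" "a \<cdot>\<^bsub>G\<^esub> ?d = b"
    using G in_G by (simp_all add: ldiv_closed)
  have "b \<cdot>\<^bsub>G\<^esub> c = (a \<cdot>\<^bsub>G\<^esub> c) \<cdot>\<^bsub>G\<^esub> ?d"
    using eq in_G d by metis
  then show "a \<cdot>\<^bsub>G\<^esub> ldiv G (a \<cdot>\<^bsub>G\<^esub> c) (b \<cdot>\<^bsub>G\<^esub> c) = b"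
    using G in_G d by (simp add: ldiv_bop bop_closed)
qed

text \<open>As \<open>c\<close> runs through \<open>b * e\<close>, the inner value \<open>\<mu>\<^sub>1(a, b, c)\<close> is
  \<open>a * e\<close>.\<close>

lemma mu1_involution_iff:
  assumes G: "left_quasigroup G"
  shows "(\<forall>a\<in>carrier G. \<forall>b\<in>carrier G. \<forall>c\<in>carrier G. mu1 G a (mu1 G a b c) c = b) \<longleftrightarrow>
    (\<forall>a\<in>carrier G. \<forall>b\<in>carrier G. \<forall>c\<in>carrier G.
      a \<cdot>\<^bsub>G\<^esub> ldiv G (a \<cdot>\<^bsub>G\<^esub> c) (b \<cdot>\<^bsub>G\<^esub> c) = b)"
proof -
  have "(\<forall>c\<in>carrier G. mu1 G a (mu1 G a b c) c = b) \<longleftrightarrow>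
    (\<forall>e\<in>carrier G. a \<cdot>\<^bsub>G\<^esub> ldiv G (a \<cdot>\<^bsub>G\<^esub> e) (b \<cdot>\<^bsub>G\<^esub> e) = b)"
    if b: "b \<in> carrier G" for a b
    unfolding mu1_def using G b by (metis bop_closed ldiv_closed ldiv_bop)
  then show ?thesis by simp
qed

text \<open>The involution identity for \<open>\<mu>\<^sub>2\<close> is that for \<open>\<mu>\<^sub>1\<close> with the outer arguments
  exchanged.\<close>

lemma mu2_eq_mu1_flip: "mu2 G a b c = mu1 G c b a"
  by (simp add: mu1_def mu2_def)

theorem proposition7p3:
  fixes G :: "'g binary_system" and L :: "'l binary_system"
    and M :: "'g ternary_system" and \<pi> :: "'l \<Rightarrow> 'g"
  assumes "left_quasigroup G"
    and "\<forall>a\<in>carrier G. \<forall>a'\<in>carrier G. \<forall>b\<in>carrier G. \<forall>c\<in>carrier G.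
           ldiv G (a \<cdot>\<^bsub>G\<^esub> c) ((a \<cdot>\<^bsub>G\<^esub> b) \<cdot>\<^bsub>G\<^esub> c) = ldiv G (a' \<cdot>\<^bsub>G\<^esub> c) ((a' \<cdot>\<^bsub>G\<^esub> b) \<cdot>\<^bsub>G\<^esub> c)"
    and "M = \<lparr>carrier = carrier G, top3 = mu1 G\<rparr> \<or> M = \<lparr>carrier = carrier G, top3 = mu2 G\<rparr>"
    and "left_quasigroup L"
    and "bij_betw \<pi> (carrier L) (carrier G)"
  shows "unitary_condition L (R_map L M \<pi>) \<longleftrightarrow>
    (\<forall>a\<in>carrier G. \<forall>b\<in>carrier G. \<forall>c\<in>carrier G.
       (a \<cdot>\<^bsub>G\<^esub> b) \<cdot>\<^bsub>G\<^esub> c = (a \<cdot>\<^bsub>G\<^esub> c) \<cdot>\<^bsub>G\<^esub> b)"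
proof -
  have M: "is_ternary_system M" and carrier_M: "carrier M = carrier G"
    using assms(1,3) is_ternary_system_mu1 is_ternary_system_mu2 by auto
  have "unitary_condition L (R_map L M \<pi>) \<longleftrightarrow>
    (\<forall>a\<in>carrier G. \<forall>b\<in>carrier G. \<forall>c\<in>carrier G. top3 M a (top3 M a b c) c = b)"
    using unitary_iff_involution[OF assms(4) M, of \<pi>] assms(5) carrier_M by simp
  also have "\<dots> \<longleftrightarrow>
    (\<forall>a\<in>carrier G. \<forall>b\<in>carrier G. \<forall>c\<in>carrier G. mu1 G a (mu1 G a b c) c = b)"
    using assms(3) by (auto simp: mu2_eq_mu1_flip)
  finally show ?thesis
    using mu1_involution_iff[OF assms(1)] right_translation_preserves_ldiv_iff[OF assms(1)]
    by simp
qed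

end
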